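(* Let $p\ge 5$ be a prime and let $n,i\ge 1$ be integers with $i<\frac{p}{3}$. Then $$a_i(pn)\equiv 0\pmod{p^2}.$$
   Context: For integers $i\ge 0$ and $n\ge 1$, define $$a_i(n)=\sum_{k=0}^{\lfloor (n-i)/3\rfloor}(-1)^{n-k}\binom{3k+i}{k}\binom{2k+i}{k}\binom{n}{3k+i}\binom{n+k}{k}3^{n-3k-i}.$$ *)

theory Defs
  imports Complex_Main "HOL-Number_Theory.Cong"
begin

text \<open>
  The upper summation bound is the floor of \<open>(n - i) / 3\<close>, rendered by rounding-down division on
  the integers, so that the sum is empty when \<open>n < i\<close>.  Every \<open>k\<close> in the range satisfies
  \<open>3 * k + i \<le> n\<close>, hence the natural-number subtractions in the exponents do not truncate.
\<close>

definition a :: "nat \<Rightarrow> nat \<Rightarrow> int" where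
  "a i n = (\<Sum>k\<in>{k::nat. int k \<le> (int n - int i) div 3}.
     (-1) ^ (n - k) * int ((3 * k + i) choose k) * int ((2 * k + i) choose k)
       * int (n choose (3 * k + i)) * int ((n + k) choose k) * 3 ^ (n - 3 * k - i))"

end

theory Submission
  imports Defs "HOL-Number_Theory.Residues"
begin

text \<open>
  Put \<open>N = p * n\<close> and \<open>k = p * s + r\<close> with \<open>r < p\<close>.  The product
  \<open>X k = (N choose (3 * k + i)) * ((3 * k + i) choose (k + i)) * ((2 * k) choose k)\<close> is always divisible
  by \<open>p\<close>: through its first factor if \<open>p\<close> does not divide \<open>3 * k + i\<close>, and through its second
  factor otherwise, since then \<open>p\<close> does not divide \<open>k + i\<close>.  Lucas' theorem, lifted to modulus \<open>p\<^sup>2\<close> for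
  \<open>(p * n) choose (p * u + v)\<close> with \<open>0 < v < p\<close>, shows that modulo \<open>p\<^sup>2\<close> it splits into a factor
  depending only on \<open>s\<close> and the same product with \<open>n = 1\<close>, \<open>k = r\<close>.  All other factors matter only
  modulo \<open>p\<close> and split too, so \<open>a i N\<close> is congruent to a multiple of the alternating sum
  of \<open>p! / ((w - 3r)! (r + i)! r!\<^sup>2) * 3 ^ (w - 3r)\<close> over \<open>r\<close>, where \<open>w = p - i\<close>.
  Since \<open>p! / (r + i)!\<close> is congruent to \<open>p * (-1) ^ (w - r - 1) * (w - r - 1)!\<close>, this sum is,
  modulo \<open>p\<^sup>2\<close> and up to sign, \<open>p\<close> times the sum of
  \<open>3 ^ (w - 3r) * (w - r - 1)! / ((w - 3r)! r!\<^sup>2)\<close>.  The latter is a Saalschuetz sum with value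
  \<open>3 * (2w - 1)! / w!\<^sup>2\<close>, which is divisible by \<open>p\<close> because \<open>w < p \<le> 2w - 1\<close>.
\<close>

section \<open>Lucas' theorem and its lift to modulus p^2\<close>

text \<open>Induction by Pascal's rule, tracking base-p digits. If the last digit \<open>v\<close>
  overflows but \<open>y\<close> does not, the two lower binomials add up to
  \<open>p choose Suc y\<close>, which vanishes modulo \<open>p\<close>; the other cases are
  Pascal's rule on a single digit.\<close>

lemma binomial_lucas:
  fixes p :: nat
  assumes "prime p"
  shows "[n choose k = ((n div p) choose (k div p)) * ((n mod p) choose (k mod p))] (mod p)"
proof (induction n arbitrary: k)
  case 0
  have p: "p > 0" using assms prime_gt_0_nat by blast
  show ?case
  proof (cases "k = 0")
    case False
    then have "k div p > 0 \<or> k mod p > 0"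
      by (metis bot_nat_0.not_eq_extremum div_mult_mod_eq mult_0 add.right_neutral)
    then show ?thesis using False by (auto simp: binomial_eq_0)
  qed simp
next
  case (Suc n)
  have p: "p > 1" using assms prime_gt_1_nat by blast
  show ?case
  proof (cases k)
    case (Suc j)
    define u v where "u = n div p" and "v = n mod p"
    define x y where "x = j div p" and "y = j mod p"
    have n: "n = p * u + v" and j: "j = p * x + y" by (simp_all add: u_def v_def x_def y_def)
    have v: "v < p" and y: "y < p" using p by (simp_all add: v_def y_def)
    have divmod: "Suc m div p = (if m mod p = p - 1 then Suc (m div p) else m div p)"
        "Suc m mod p = (if m mod p = p - 1 then 0 else Suc (m mod p))" for m
      using p by (auto simp: div_Suc mod_Suc)
    have "[Suc n choose k = (u choose x) * (v choose y) + (u choose (k div p)) * (v choose (k mod p))] (mod p)"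
      using cong_add[OF Suc.IH[of j] Suc.IH[of k]] Suc by (simp add: u_def v_def x_def y_def)
    also have "[(u choose x) * (v choose y) + (u choose (k div p)) * (v choose (k mod p)) =
        ((Suc n div p) choose (k div p)) * ((Suc n mod p) choose (k mod p))] (mod p)"
    proof (cases "y = p - 1")
      case True
      then have k: "k div p = Suc x" "k mod p = 0"
        using Suc by (simp_all add: divmod x_def y_def)
      show ?thesis
      proof (cases "v = p - 1")
        case True
        then show ?thesis using k \<open>y = p - 1\<close> by (simp add: divmod flip: u_def v_def)
      next
        case False
        then have "v < y" using v True by simp
        then show ?thesis using k False by (simp add: divmod binomial_eq_0 flip: u_def v_def)
      qed
    next
      case False
      then have k: "k div p = x" "k mod p = Suc y"
        using Suc by (simp_all add: divmod x_def y_def)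
      show ?thesis
      proof (cases "v = p - 1")
        case True
        have "p dvd (p choose Suc y)"
          using False y assms by (intro dvd_choose_prime) auto
        moreover have "(v choose y) + (v choose Suc y) = p choose Suc y"
          using True p by (metis Suc_diff_1 binomial_Suc_Suc zero_less_one less_trans)
        ultimately have "p dvd (u choose x) * (v choose y) + (u choose x) * (v choose Suc y)"
          by (metis dvd_mult distrib_left)
        then show ?thesis using k True by (simp add: divmod cong_0_iff flip: u_def v_def)
      next
        case False
        then show ?thesis using k by (simp add: divmod distrib_left flip: u_def v_def)
      qed
    qed
    finally show ?thesis .
  qed simp
qed

lemma binomial_lucas':
  fixes p :: nat
  assumes "prime p" "v < p" "y < p"
  shows "[(p * u + v) choose (p * x + y) = (u choose x) * (v choose y)] (mod p)"
  using binomial_lucas[OF assms(1), of "p * u + v" "p * x + y"] assms by simp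

text \<open>The last base-p digit of \<open>m\<close> is 0 and that of \<open>k\<close> is positive,
  so the Lucas factor for this digit is 0.\<close>

lemma prime_dvd_binomial:
  fixes p :: nat
  assumes "prime p" "p dvd m" "\<not> p dvd k"
  shows "p dvd (m choose k)"
  using binomial_lucas[OF assms(1), of m k] assms
  by (simp add: cong_0_iff mod_greater_zero_iff_not_dvd binomial_eq_0)

text \<open>Absorption exhibits a factor \<open>p\<close>, so the remaining binomial is needed only
  modulo \<open>p\<close>, where Lucas applies.\<close>

lemma binomial_prime_mult_cong:
  fixes p :: nat
  assumes "prime p" "0 < v" "v < p"
  shows "[(p * Suc n) choose (p * u + v) = Suc n * (n choose u) * (p choose v)] (mod p\<^sup>2)"
proof -
  define m where "m = p * u + v"
  have p: "p > 1" using assms prime_gt_1_nat by blast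
  have pn: "p * Suc n - 1 = p * n + (p - 1)" using p by simp
  have m1: "m - 1 = p * u + (v - 1)" using assms by (simp add: m_def)
  have mC: "m * ((p * Suc n) choose m) = p * Suc n * ((p * Suc n - 1) choose (m - 1))"
    using assms by (intro times_binomial_minus1_eq) (simp add: m_def)
  have "coprime p m" using assms unfolding m_def
    by (metis coprime_commute coprime_iff_gcd_eq_1 gcd_add_mult nat_dvd_not_less prime_imp_coprime mult.commute add.commute)
  then have "p dvd ((p * Suc n) choose m)"
    using mC by (metis coprime_dvd_mult_right_iff dvd_triv_left mult.assoc)
  then obtain c where c: "(p * Suc n) choose m = p * c" by blast
  have "[(p * Suc n - 1) choose (m - 1) = (n choose u) * ((p - 1) choose (v - 1))] (mod p)"
    unfolding pn m1 using assms p by (intro binomial_lucas') auto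
  then have "[p * ((p * Suc n - 1) choose (m - 1)) = p * ((n choose u) * ((p - 1) choose (v - 1)))] (mod p * p)"
    by (metis cong_cmult_leftI)
  from cong_scalar_left[OF this, of "Suc n"]
  have 1: "[m * ((p * Suc n) choose m) = Suc n * (n choose u) * (p * ((p - 1) choose (v - 1)))] (mod p * p)"
    unfolding mC by (simp only: ac_simps)
  have 2: "p * ((p - 1) choose (v - 1)) = v * (p choose v)"
    using assms by (simp add: times_binomial_minus1_eq)
  \<comment> \<open>The prefactor \<open>m\<close> may be replaced by its last digit
    \<open>v\<close>: they differ by \<open>p * u\<close>, and the binomial has a factor
    \<open>p\<close> of its own. Then \<open>v\<close> is invertible and cancels.\<close>
  have "m * ((p * Suc n) choose m) = v * ((p * Suc n) choose m) + (p * p) * (u * c)"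
    unfolding c by (simp add: m_def algebra_simps)
  then have "[v * ((p * Suc n) choose m) = m * ((p * Suc n) choose m)] (mod p * p)"
    by (metis cong_def mod_mult_self2)
  from cong_trans[OF this 1]
  have "[v * ((p * Suc n) choose m) = v * (Suc n * (n choose u) * (p choose v))] (mod p * p)"
    unfolding 2 by (simp only: ac_simps)
  moreover have "coprime v (p * p)"
    using assms by (metis coprime_commute coprime_mult_left_iff nat_dvd_not_less prime_imp_coprime)
  ultimately show ?thesis
    by (metis cong_mult_lcancel_nat m_def power2_eq_square)
qed

section \<open>A Saalschuetz sum in closed form\<close>

text \<open>The value 0 beyond \<open>3 * r \<le> w\<close> is set by hand, since truncated
  subtraction would leave a nonzero quotient there.\<close>

definition wz_term :: "nat \<Rightarrow> nat \<Rightarrow> real" where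
  "wz_term w r = (if 3 * r \<le> w
     then 3 ^ (w - 3 * r) * fact (w - r - 1) / (fact (w - 3 * r) * fact r ^ 2) else 0)"

text \<open>
  The Wilf--Zeilberger certificate: in terms of the summand \<open>f w r\<close> it is
  \<open>- 27 * (w - r) * r\<^sup>2 / (w + 1 - 3 * r) * f w r\<close>, rewritten so as to make sense at
  \<open>3 * r = w + 1\<close>.
\<close>

definition wz_cert :: "nat \<Rightarrow> nat \<Rightarrow> real" where
  "wz_cert w r = (if 3 * r \<le> w + 1
     then - 9 * 3 ^ (w + 1 - 3 * r) * fact (w - r) * r ^ 2 / (fact (w + 1 - 3 * r) * fact r ^ 2) else 0)"

text \<open>Generically this is a polynomial identity times a common hypergeometric factor. The
  boundary values of \<open>3 * r\<close>, where some but not all of the four quantities vanish, are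
  computed separately.\<close>

lemma wz_telescope:
  assumes "w \<ge> 1"
  shows "(real w + 1)^2 * wz_term (Suc w) r - 2 * w * (2 * w + 1) * wz_term w r = wz_cert w (Suc r) - wz_cert w r"
proof -
  consider "3 * r > w + 1" | "3 * r = w + 1" | "3 * r = w" | "w = 3 * r + 1" | t where "w = 3 * r + 2 + t"
    by (metis add.commute add_2_eq_Suc' add_Suc_right less_eqE linorder_cases Suc_eq_plus1 Suc_leI not_less_eq less_antisym)
  then show ?thesis
  proof cases
    case 1
    then show ?thesis by (simp add: wz_term_def wz_cert_def)
  next
    case 2
    then obtain q where q: "r = Suc q" by (cases r) auto
    then have w: "w = 3 * q + 2" using 2 by simp
    show ?thesis unfolding w q
      by (simp add: wz_term_def wz_cert_def divide_simps) (simp add: algebra_simps power2_eq_square)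
  next
    case 3
    \<comment> \<open>\<open>w \<ge> 1\<close> excludes \<open>r = 0\<close>, where
      \<open>w - r - 1\<close> would truncate.\<close>
    then obtain q where q: "r = Suc q" using assms by (cases r) auto
    then have w: "w = 3 * q + 3" using 3 by simp
    show ?thesis unfolding w q
      by (simp add: wz_term_def wz_cert_def divide_simps) (simp add: algebra_simps power2_eq_square)
  next
    case w: 4
    show ?thesis unfolding w
      by (simp add: wz_term_def wz_cert_def divide_simps) (simp add: algebra_simps power2_eq_square)
  next
    case w: (5 t)
    define A where "A = (fact (2 * r + 1 + t) :: real)"
    define B where "B = (fact t :: real)"
    define C where "C = (fact r :: real)"
    have A2: "fact (2 * r + 2 + t) = (2 * r + 2 + t) * A"
      by (simp add: A_def algebra_simps)
    have B2: "fact (t + 2) = (t + 2) * (t + 1) * B" and B3: "fact (t + 3) = (t + 3) * (t + 2) * (t + 1) * B"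
      by (simp_all add: B_def algebra_simps numeral_eq_Suc)
    have e1: "wz_term (Suc w) r = 3 ^ t * 27 * ((2 * r + 2 + t) * A) / ((t + 3) * (t + 2) * (t + 1) * B * C ^ 2)"
    proof -
      have "Suc w - 3 * r = t + 3" "Suc w - r - 1 = 2 * r + 2 + t" "3 * r \<le> Suc w" using w by auto
      then show ?thesis by (simp only: wz_term_def A2 B3 C_def) (simp add: power_add)
    qed
    have e2: "wz_term w r = 3 ^ t * 9 * A / ((t + 2) * (t + 1) * B * C ^ 2)"
    proof -
      have "w - 3 * r = t + 2" "w - r - 1 = 2 * r + 1 + t" "3 * r \<le> w" using w by auto
      then show ?thesis by (simp only: wz_term_def B2 C_def A_def) (simp add: power_add)
    qed
    have e3: "wz_cert w (Suc r) = - 9 * 3 ^ t * A / (B * C ^ 2)"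
    proof -
      have "w + 1 - 3 * Suc r = t" "w - Suc r = 2 * r + 1 + t" "3 * Suc r \<le> w + 1" using w by auto
      then show ?thesis by (simp only: wz_cert_def B_def C_def A_def) (simp add: divide_simps power_mult_distrib)
    qed
    have e4: "wz_cert w r = - 9 * 3 ^ t * 27 * ((2 * r + 2 + t) * A) * r ^ 2 / ((t + 3) * (t + 2) * (t + 1) * B * C ^ 2)"
    proof -
      have "w + 1 - 3 * r = t + 3" "w - r = 2 * r + 2 + t" "3 * r \<le> w + 1" using w by auto
      then show ?thesis by (simp only: wz_cert_def A2 B3 C_def) (simp add: power_add)
    qed
    have rw: "real w = 3 * r + 2 + t" by (simp add: w)
    define a1 a2 a3 where a: "a1 = real t + 1" "a2 = real t + 2" "a3 = real t + 3"
    have a0: "a1 \<noteq> 0" "a2 \<noteq> 0" "a3 \<noteq> 0" by (simp_all add: a)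
    have prods: "real ((t + 2) * (t + 1)) = a2 * a1" "real ((t + 3) * (t + 2) * (t + 1)) = a3 * a2 * a1"
      by (simp_all add: a algebra_simps)
    \<comment> \<open>\<open>F\<close> is the common factor of all four quantities, and
      \<open>b\<close> is \<open>w - r\<close>; what remains is polynomial in \<open>r\<close> and
      \<open>t\<close>.\<close>
    define F where "F = 3 ^ t * A / (a3 * a2 * a1 * B * C ^ 2)"
    define b where "b = real (2 * r + 2 + t)"
    have f1: "wz_term (Suc w) r = 27 * b * F"
      unfolding e1 F_def prods b_def[symmetric] by simp
    have f2: "wz_term w r = 9 * a3 * F"
      unfolding e2 F_def prods using a0 by (simp add: mult_ac)
    have f3: "wz_cert w (Suc r) = - 9 * (a3 * a2 * a1) * F"
      unfolding e3 F_def using a0 by (simp add: mult_ac)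
    have f4: "wz_cert w r = - 243 * b * r ^ 2 * F"
      unfolding e4 F_def prods b_def[symmetric] by simp
    show ?thesis unfolding f1 f2 f3 f4 rw a b_def
      by (simp add: algebra_simps power2_eq_square)
  qed
qed

text \<open>Summing \<open>wz_telescope\<close> gives a first-order recurrence in the upper
  parameter, which the closed form also satisfies. With parameter \<open>Suc w\<close>, the
  factorial of twice the parameter minus one needs no subtraction.\<close>

lemma wz_sum:
  "(\<Sum>r<w + 2. wz_term (Suc w) r) = 3 * fact (2 * w + 1) / fact (Suc w) ^ 2"
proof (induction w)
  case 0
  show ?case by (simp add: wz_term_def numeral_eq_Suc)
next
  case (Suc w)
  let ?W = "Suc w"
  have "(\<Sum>r<w + 3. (real ?W + 1)^2 * wz_term (Suc ?W) r - 2 * real ?W * (2 * real ?W + 1) * wz_term ?W r) =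
      (\<Sum>r<w + 3. wz_cert ?W (Suc r) - wz_cert ?W r)"
    by (rule sum.cong[OF refl wz_telescope]) simp
  \<comment> \<open>The certificate vanishes at both ends: at 0 by its factor \<open>r ^ 2\<close>,
    at \<open>w + 3\<close> by being out of range.\<close>
  also have "\<dots> = 0"
    by (subst sum_lessThan_telescope) (simp add: wz_cert_def)
  finally have "(real ?W + 1)^2 * (\<Sum>r<w + 3. wz_term (Suc ?W) r) = 2 * real ?W * (2 * real ?W + 1) * (\<Sum>r<w + 3. wz_term ?W r)"
    by (simp add: sum_subtractf sum_distrib_left)
  also have "(\<Sum>r<w + 3. wz_term ?W r) = (\<Sum>r<w + 2. wz_term ?W r)"
    by (intro sum.mono_neutral_right) (auto simp: wz_term_def)
  finally have eq: "(real ?W + 1)^2 * (\<Sum>r<w + 3. wz_term (Suc ?W) r) =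
      2 * real ?W * (2 * real ?W + 1) * (3 * fact (2 * w + 1) / fact (Suc w) ^ 2)"
    unfolding Suc.IH .
  have u1: "fact (2 * ?W + 1) = (2 * real ?W + 1) * (2 * real ?W) * fact (2 * w + 1)"
    by (simp add: algebra_simps)
  have u2: "fact (Suc ?W) = (real ?W + 1) * fact ?W"
    by (simp add: algebra_simps)
  have u3: "(\<Sum>r<w + 3. wz_term (Suc ?W) r) =
      2 * real ?W * (2 * real ?W + 1) * (3 * fact (2 * w + 1) / fact ?W ^ 2) / (real ?W + 1)^2"
    unfolding eq[symmetric] by (rule nonzero_mult_div_cancel_left[symmetric]) simp
  have u4: "2 * x * (2 * x + 1) * (3 * P / Q ^ 2) / z ^ 2 = 3 * ((2 * x + 1) * (2 * x) * P) / (z * Q) ^ 2" for x z P Q :: real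
    by (simp add: power_mult_distrib mult_ac)
  have "(\<Sum>r<w + 3. wz_term (Suc ?W) r) = 3 * fact (2 * ?W + 1) / fact (Suc ?W) ^ 2"
    unfolding u1 u2 u3 by (rule u4)
  moreover have "w + 3 = ?W + 2" by simp
  ultimately show ?case by (simp only:)
qed

section \<open>Congruences modulo p^2 and the sum for n = 1\<close>

text \<open>In \<open>c * (a - b)\<close> each factor contributes one \<open>p\<close>. Thus a
  factor divisible by \<open>p\<close> allows its cofactor to be handled modulo \<open>p\<close>
  only.\<close>

lemma cong_mult_prime_square:
  fixes p a b c :: "'a :: {unique_euclidean_ring}"
  assumes "p dvd c" "[a = b] (mod p)"
  shows "[c * a = c * b] (mod p\<^sup>2)"
  using assms by (auto simp: cong_iff_dvd_diff power2_eq_square mult_dvd_mono simp flip: right_diff_distrib)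

lemma falling_product_fact:
  "m \<le> p \<Longrightarrow> fact (p - m) * (\<Prod>j<m. int p - int j) = fact p"
proof (induction m)
  case (Suc m)
  have "fact (p - m) = (int p - int m) * fact (p - Suc m)"
    using Suc.prems fact_reduce[of "p - m", where 'a = int] by (simp add: of_nat_diff)
  with Suc show ?case by (simp add: mult_ac)
qed simp

text \<open>The factor at \<open>j = 0\<close> is \<open>p\<close> itself; each of the others is
  congruent to \<open>- j\<close> modulo \<open>p\<close>.\<close>

lemma falling_product_cong:
  "[(\<Prod>j<Suc m. int p - int j) = int p * ((-1) ^ m * fact m)] (mod (int p)\<^sup>2)"
proof -
  have "[(\<Prod>j<m. int p - int (Suc j)) = (\<Prod>j<m. - int (Suc j))] (mod int p)"
    by (intro cong_prod) (simp add: cong_iff_dvd_diff)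
  also have "(\<Prod>j<m. - int (Suc j)) = (-1) ^ m * fact m"
    by (induction m) (simp_all add: algebra_simps)
  finally have "[int p * (\<Prod>j<m. int p - int (Suc j)) = int p * ((-1) ^ m * fact m)] (mod (int p)\<^sup>2)"
    by (intro cong_mult_prime_square) auto
  then show ?thesis by (simp add: prod.lessThan_Suc_shift del: prod.lessThan_Suc)
qed

text \<open>Multiplying by \<open>fact w\<close>, which is coprime to \<open>p\<close>, clears the
  denominators, so all congruences stay between integers.\<close>

lemma truncated_sum_cong_0:
  fixes p i :: nat
  assumes "prime p" "i \<ge> 1" "3 * i < p"
  shows "[(\<Sum>r<p. (-1) ^ r * int ((p choose (3 * r + i)) * ((3 * r + i) choose (r + i)) * ((2 * r) choose r))
           * 3 ^ (p - 3 * r - i)) = 0] (mod (int p)\<^sup>2)"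
    (is "[(\<Sum>r<p. ?t r) = 0] (mod _)")
proof -
  define w where "w = p - i"
  \<comment> \<open>This is \<open>fact w / (fact (w - 3 * r) * fact r ^ 2)\<close>, written with
    binomials to be visibly an integer.\<close>
  define c where "c r = int ((w choose (3 * r)) * ((3 * r) choose r) * ((2 * r) choose r) * fact r)" for r
  define Z where "Z = (\<Sum>r<w + 1. 3 ^ (w - 3 * r) * c r * fact (w - r - 1))"
  have w: "p = w + i" "w \<ge> 1" "w < p" "p \<le> 2 * w - 1" using assms by (simp_all add: w_def)
  have c_fact: "real_of_int (c r) = fact w / (fact (w - 3 * r) * fact r ^ 2)" if "3 * r \<le> w" for r
  proof -
    have "3 * r - r = 2 * r" "2 * r - r = r" by auto
    then show ?thesis using that by (simp add: c_def binomial_fact field_simps power2_eq_square)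
  qed
  have term_fact: "fact w * int ((p choose (3 * r + i)) * ((3 * r + i) choose (r + i)) * ((2 * r) choose r)) =
      c r * (\<Prod>j<w - r. int p - int j)" if "3 * r \<le> w" for r
  proof -
    \<comment> \<open>The \<open>w - r\<close> factors run from \<open>p\<close> down to
      \<open>r + i + 1\<close>, so their product is \<open>fact p / fact (r + i)\<close>.\<close>
    have "p - (w - r) = r + i" using w that by simp
    then have "fact (r + i) * (\<Prod>j<w - r. int p - int j) = fact p"
      using falling_product_fact[of "w - r" p] w by simp
    then have "real_of_int (\<Prod>j<w - r. int p - int j) = fact p / fact (r + i)"
      by (metis eq_divide_eq_numeral fact_nonzero nonzero_mult_div_cancel_left of_int_fact of_int_mult)
    moreover have "p - (3 * r + i) = w - 3 * r" "3 * r + i - (r + i) = 2 * r" "2 * r - r = r"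
      "3 * r + i \<le> p" using w that by auto
    ultimately have "real_of_int (fact w * int ((p choose (3 * r + i)) * ((3 * r + i) choose (r + i)) * ((2 * r) choose r))) =
      real_of_int (c r * (\<Prod>j<w - r. int p - int j))"
      by (simp only: of_int_mult c_fact[OF that])
         (simp add: binomial_fact field_simps power2_eq_square)
    then show ?thesis by (simp only: of_int_eq_iff)
  qed
  have "[fact w * ?t r = int p * (-1) ^ (w - 1) * (3 ^ (w - 3 * r) * c r * fact (w - r - 1))] (mod (int p)\<^sup>2)" for r
  proof (cases "3 * r \<le> w")
    case True
    define q where "q = w - r - 1"
    have q: "w - r = Suc q" "w - 1 = r + q" using True w by (auto simp: q_def)
    have e: "p - 3 * r - i = w - 3 * r" using w by simp
    have "fact w * ?t r = (-1) ^ r * 3 ^ (w - 3 * r) *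
        (fact w * int ((p choose (3 * r + i)) * ((3 * r + i) choose (r + i)) * ((2 * r) choose r)))"
      unfolding e by (simp only: mult_ac)
    also have "\<dots> = (-1) ^ r * 3 ^ (w - 3 * r) * c r * (\<Prod>j<Suc q. int p - int j)"
      unfolding term_fact[OF True] q by (simp only: mult_ac)
    also have "[\<dots> = (-1) ^ r * 3 ^ (w - 3 * r) * c r * (int p * ((-1) ^ q * fact q))] (mod (int p)\<^sup>2)"
      by (intro cong_scalar_left falling_product_cong)
    \<comment> \<open>The sign of the falling product absorbs \<open>(-1) ^ r\<close>: since
      \<open>r + q = w - 1\<close>, the total sign no longer depends on \<open>r\<close>.\<close>
    also have "(-1) ^ r * 3 ^ (w - 3 * r) * c r * (int p * ((-1) ^ q * fact q)) =
        int p * (-1) ^ (w - 1) * (3 ^ (w - 3 * r) * c r * fact (w - r - 1))"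
      unfolding q by (simp add: power_add mult_ac)
    finally show ?thesis .
  next
    case False
    then show ?thesis using w by (simp add: c_def binomial_eq_0)
  qed
  then have "[(\<Sum>r<p. fact w * ?t r) =
      (\<Sum>r<p. int p * (-1) ^ (w - 1) * (3 ^ (w - 3 * r) * c r * fact (w - r - 1)))] (mod (int p)\<^sup>2)"
    by (intro cong_sum)
  also have "(\<Sum>r<p. int p * (-1) ^ (w - 1) * (3 ^ (w - 3 * r) * c r * fact (w - r - 1))) =
      (\<Sum>r<w + 1. int p * (-1) ^ (w - 1) * (3 ^ (w - 3 * r) * c r * fact (w - r - 1)))"
    using w by (intro sum.mono_neutral_right) (auto simp: c_def binomial_eq_0)
  finally have D: "[fact w * (\<Sum>r<p. ?t r) = int p * (-1) ^ (w - 1) * Z] (mod (int p)\<^sup>2)"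
    by (simp only: sum_distrib_left Z_def)
  have "real_of_int Z = (\<Sum>r<w + 1. fact w * wz_term w r)"
    unfolding Z_def of_int_sum
  proof (rule sum.cong[OF refl])
    fix r
    show "real_of_int (3 ^ (w - 3 * r) * c r * fact (w - r - 1)) = fact w * wz_term w r"
      by (cases "3 * r \<le> w") (simp add: c_fact wz_term_def, simp add: wz_term_def c_def binomial_eq_0)
  qed
  also have "\<dots> = fact w * (3 * fact (2 * w - 1) / fact w ^ 2)"
  proof -
    obtain v where v: "w = Suc v" using w(2) by (cases w) auto
    show ?thesis using wz_sum[of v] unfolding v by (simp flip: sum_distrib_left)
  qed
  finally have "real_of_int (fact w * Z) = real_of_int (3 * fact (2 * w - 1))"
    by (simp add: field_simps power2_eq_square)
  then have Z: "fact w * Z = 3 * fact (2 * w - 1)" by (simp only: of_int_eq_iff)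
  have pp: "prime (int p)" using assms by simp
  have nd: "\<not> int p dvd fact w"
    using w assms(1) by (metis not_less int_dvd_int_iff of_nat_fact prime_dvd_fact_iff)
  have "int p dvd fact (2 * w - 1)"
    using w assms(1) by (metis int_dvd_int_iff of_nat_fact prime_dvd_fact_iff)
  then have "int p dvd fact w * Z" using Z by simp
  then have "int p dvd Z" using nd pp prime_dvd_multD by blast
  then have "(int p)\<^sup>2 dvd int p * (-1) ^ (w - 1) * Z"
    by (simp add: power2_eq_square mult_dvd_mono)
  then have "(int p)\<^sup>2 dvd fact w * (\<Sum>r<p. ?t r)"
    using cong_dvd_iff[OF D] by blast
  moreover have "coprime ((int p)\<^sup>2) (fact w)"
    using nd pp by (simp add: prime_imp_coprime)
  ultimately show ?thesis by (simp only: coprime_dvd_mult_right_iff cong_0_iff)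
qed

section \<open>Splitting the product along base-p digits\<close>

text \<open>If \<open>3 * r + i > p\<close>, both sides vanish modulo p^2: two factors
  \<open>p\<close> are found in \<open>X\<close>, and \<open>p choose (3 * r + i)\<close> is 0.
  Otherwise exactly one binomial is lifted to modulus p^2, the others being needed modulo
  \<open>p\<close>.\<close>

lemma product_block_cong:
  fixes p i n s r :: nat
  assumes "prime p" "i \<ge> 1" "3 * i < p" "r < p"
  defines "k \<equiv> p * s + r"
  defines "X \<equiv> ((p * Suc n) choose (3 * k + i)) * ((3 * k + i) choose (k + i)) * ((2 * k) choose k)"
  shows "[X = (Suc n * (n choose (3 * s)) * ((3 * s) choose s) * ((2 * s) choose s)) *
      ((p choose (3 * r + i)) * ((3 * r + i) choose (r + i)) * ((2 * r) choose r))] (mod p\<^sup>2)" (is ?A)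
    and "p dvd X" (is ?B)
proof -
  have m: "3 * k + i = p * (3 * s) + (3 * r + i)" and k2: "2 * k = p * (2 * s) + 2 * r"
    and ki: "k + i = p * s + (r + i)"
    by (simp_all add: k_def algebra_simps)
  have d1: "p dvd ((p * Suc n) choose (3 * k + i))" if "\<not> p dvd 3 * k + i"
    using that assms(1) by (intro prime_dvd_binomial) auto
  have sq: "p * p dvd x * y" if "p dvd x" "p dvd y" for x y :: nat
    using that by (rule mult_dvd_mono)
  have cong_pp: "[x * y = x' * y'] (mod p * p)" if "[x = x'] (mod p * p)" "p dvd x" "[y = y'] (mod p)" for x x' y y' :: nat
  proof -
    from that(2) obtain z where z: "x = p * z" by blast
    have "[p * y = p * y'] (mod p * p)" using that(3) by (rule cong_cmult_leftI)
    then have "[x * y = x * y'] (mod p * p)"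
      unfolding z by (metis cong_scalar_left mult.assoc mult.commute)
    also have "[x * y' = x' * y'] (mod p * p)" using that(1) by (rule cong_scalar_right)
    finally show ?thesis .
  qed
  consider (big) "p \<le> 2 * r" | (mid) "2 * r < p" "p < 3 * r + i" | (lt) "3 * r + i < p" | (eq) "3 * r + i = p"
    by linarith
  then have "?A \<and> ?B"
  proof cases
    case big
    have "2 * k = p * (2 * s + 1) + (2 * r - p)" using k2 big by simp
    then have "[(2 * k) choose k = ((2 * s + 1) choose s) * ((2 * r - p) choose r)] (mod p)"
      unfolding k_def using assms(1,4) by (simp only:) (intro binomial_lucas', auto)
    \<comment> \<open>Adding \<open>k\<close> to itself produces a carry, so the last-digit binomial
      is 0.\<close>
    moreover have "2 * r - p < r" using big assms(4) by linarith
    ultimately have d2: "p dvd ((2 * k) choose k)"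
      by (simp add: cong_0_iff binomial_eq_0)
    have "p dvd ((p * Suc n) choose (3 * k + i)) * ((3 * k + i) choose (k + i))"
    proof (cases "p dvd 3 * k + i")
      case True
      have "\<not> p dvd k + i"
      proof
        assume "p dvd k + i"
        then have "p dvd (3 * (k + i)) - (3 * k + i)" using True by (meson dvd_diff_nat dvd_mult)
        then have "p dvd 2 * i" by simp
        then show False using assms by (auto dest: dvd_imp_le)
      qed
      then show ?thesis using True assms(1) by (simp add: prime_dvd_binomial)
    qed (rule dvd_mult2[OF d1])
    then have "p * p dvd X" using d2 unfolding X_def by (rule sq)
    moreover have "3 * r + i > p" using big assms by simp
    ultimately show ?thesis
      by (auto simp: power2_eq_square cong_0_iff binomial_eq_0 dest: dvd_mult_left)
  next
    case mid
    have m': "3 * k + i = p * (3 * s + 1) + (3 * r + i - p)" using m mid by simp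
    have lt: "3 * r + i - p < p" "r + i < p" "3 * r + i - p < r + i" using mid assms by auto
    have "\<not> p dvd 3 * k + i"
    proof
      assume "p dvd 3 * k + i"
      then have "p dvd 3 * r + i - p" unfolding m' by (metis dvd_add_right_iff dvd_triv_left)
      then show False using lt mid by (auto dest: dvd_imp_le)
    qed
    note d1 = d1[OF this]
    have "p dvd ((3 * k + i) choose (k + i))"
      unfolding m' ki using binomial_lucas'[OF assms(1) lt(1,2), of "3 * s + 1" s] lt
      by (simp add: cong_0_iff binomial_eq_0)
    with d1 have "p * p dvd X" unfolding X_def by (intro dvd_mult2 sq)
    then show ?thesis using mid
      by (auto simp: power2_eq_square cong_0_iff binomial_eq_0 dest: dvd_mult_left)
  next
    case lt
    have "[(p * Suc n) choose (3 * k + i) = Suc n * (n choose (3 * s)) * (p choose (3 * r + i))] (mod p * p)"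
      unfolding m power2_eq_square[symmetric] using assms lt by (intro binomial_prime_mult_cong) auto
    moreover have "\<not> p dvd 3 * k + i" unfolding m using lt assms(2)
      by (metis add_gr_0 dvd_add_right_iff dvd_triv_left less_le_trans nat_dvd_not_less zero_less_one)
    note d1 = d1[OF this]
    moreover have "[((3 * k + i) choose (k + i)) * ((2 * k) choose k) =
       (((3 * s) choose s) * ((3 * r + i) choose (r + i))) * (((2 * s) choose s) * ((2 * r) choose r))] (mod p)"
      unfolding m ki k2 unfolding k_def using lt assms by (intro cong_mult binomial_lucas') auto
    ultimately have "[((p * Suc n) choose (3 * k + i)) * (((3 * k + i) choose (k + i)) * ((2 * k) choose k)) =
       Suc n * (n choose (3 * s)) * (p choose (3 * r + i)) * ((((3 * s) choose s) * ((3 * r + i) choose (r + i))) * (((2 * s) choose s) * ((2 * r) choose r)))] (mod p * p)"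
      by (intro cong_pp)
    then show ?thesis using d1 by (simp add: X_def power2_eq_square mult_ac)
  next
    case eq
    \<comment> \<open>Here \<open>p\<close> divides \<open>3 * k + i\<close>, so the first binomial
      need not supply the factor \<open>p\<close>. The roles are exchanged: the second one is lifted
      to p^2.\<close>
    have m': "3 * k + i = p * Suc (3 * s)" using m eq by simp
    have "[(3 * k + i) choose (k + i) = Suc (3 * s) * ((3 * s) choose s) * (p choose (r + i))] (mod p * p)"
      unfolding m' ki power2_eq_square[symmetric] using assms eq by (intro binomial_prime_mult_cong) auto
    moreover have d2: "p dvd ((3 * k + i) choose (k + i))"
    proof (rule prime_dvd_binomial[OF assms(1)])
      show "p dvd 3 * k + i" unfolding m' by simp
      show "\<not> p dvd k + i" unfolding ki
      proof
        assume "p dvd p * s + (r + i)"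
        then have "p dvd r + i" by (metis dvd_add_right_iff dvd_triv_left)
        then show False using eq assms by (auto dest: dvd_imp_le)
      qed
    qed
    moreover have "[((p * Suc n) choose (3 * k + i)) * ((2 * k) choose k) =
       (Suc n choose Suc (3 * s)) * (((2 * s) choose s) * ((2 * r) choose r))] (mod p)"
      unfolding m' k2 unfolding k_def using eq assms binomial_lucas'[OF assms(1), of 0 0 "Suc n" "Suc (3 * s)"]
      by (intro cong_mult binomial_lucas') auto
    ultimately have "[((3 * k + i) choose (k + i)) * (((p * Suc n) choose (3 * k + i)) * ((2 * k) choose k)) =
       Suc (3 * s) * ((3 * s) choose s) * (p choose (r + i)) * ((Suc n choose Suc (3 * s)) * (((2 * s) choose s) * ((2 * r) choose r)))] (mod p * p)"
      by (intro cong_pp)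
    \<comment> \<open>Absorption, \<open>Suc (3 * s) * (Suc n choose Suc (3 * s)) = Suc n * (n
      choose (3 * s))\<close>, brings this case to the same form as the previous one.\<close>
    moreover have "Suc (3 * s) * ((3 * s) choose s) * (p choose (r + i)) * ((Suc n choose Suc (3 * s)) * (((2 * s) choose s) * ((2 * r) choose r))) =
      (Suc (3 * s) * (Suc n choose Suc (3 * s))) * ((3 * s) choose s) * (p choose (r + i)) * (((2 * s) choose s) * ((2 * r) choose r))"
      by (simp only: mult_ac)
    also have "\<dots> = (Suc n * (n choose (3 * s)) * ((3 * s) choose s) * ((2 * s) choose s)) *
      ((p choose (3 * r + i)) * ((3 * r + i) choose (r + i)) * ((2 * r) choose r))"
      unfolding Suc_times_binomial eq by (simp only: mult_ac binomial_n_n mult_1_left)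
    ultimately have "[((3 * k + i) choose (k + i)) * (((p * Suc n) choose (3 * k + i)) * ((2 * k) choose k)) =
      (Suc n * (n choose (3 * s)) * ((3 * s) choose s) * ((2 * s) choose s)) *
      ((p choose (3 * r + i)) * ((3 * r + i) choose (r + i)) * ((2 * r) choose r))] (mod p * p)"
      by (simp only:)
    moreover have "X = ((3 * k + i) choose (k + i)) * (((p * Suc n) choose (3 * k + i)) * ((2 * k) choose k))"
      unfolding X_def by (simp only: mult_ac)
    ultimately show ?thesis using d2 by (simp only: power2_eq_square dvd_mult2 simp_thms)
  qed
  then show ?A ?B by auto
qed

section \<open>Regrouping the full sum into blocks of length p\<close>

lemma three_pow_prime_mult_cong:
  fixes p q :: nat
  assumes "prime p" "p \<ge> 5"
  shows "[3 ^ (p * q) = 3 ^ q] (mod int p)"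
proof -
  have "\<not> p dvd 3" using assms by (auto dest: dvd_imp_le)
  then have "[3 * 3 ^ (p - 1) = 3 * 1] (mod p)"
    using assms(1) by (intro cong_scalar_left fermat_theorem)
  then have "[3 ^ p = 3] (mod p)"
    using assms by (simp flip: power_Suc)
  then have "[int (3 ^ p) = int 3] (mod int p)" by (simp only: cong_int_iff)
  then have "[(3 ^ p) ^ q = 3 ^ q] (mod int p)" by (intro cong_pow) simp
  then show ?thesis by (simp only: power_mult)
qed

text \<open>Both sides are the multinomial coefficient of \<open>3 * k + i\<close> with parts
  \<open>k\<close>, \<open>k\<close>, \<open>k + i\<close>. The right side exposes the lower index
  \<open>k + i\<close>, which \<open>p\<close> does not divide whenever it divides
  \<open>3 * k + i\<close>.\<close>

lemma trinomial_eq: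
  "((3 * k + i) choose k) * ((2 * k + i) choose k) = ((3 * k + i) choose (k + i)) * ((2 * k) choose k)"
proof -
  have "real (((3 * k + i) choose k) * ((2 * k + i) choose k)) =
      real (((3 * k + i) choose (k + i)) * ((2 * k) choose k))"
  proof -
    have e: "3 * k + i - k = 2 * k + i" "2 * k + i - k = k + i" "3 * k + i - (k + i) = 2 * k" "2 * k - k = k"
      by auto
    show ?thesis by (simp add: binomial_fact e)
  qed
  then show ?thesis by (simp only: of_nat_eq_iff)
qed

theorem theorem3p1:
  fixes p n i :: nat
  assumes "prime p" and "p \<ge> 5"
    and "n \<ge> 1" and "i \<ge> 1"
    and "real i < real p / 3"
  shows "[a i (p * n) = 0] (mod (int p)\<^sup>2)"
proof -
  have i: "3 * i < p" using assms(5) by linarith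
  obtain m where n: "n = Suc m" using assms(3) by (cases n) auto
  define N where "N = p * n"
  define X where "X k = (N choose (3 * k + i)) * ((3 * k + i) choose (k + i)) * ((2 * k) choose k)" for k
  define T where "T k = (-1) ^ (N - k) * int (X k) * (int ((N + k) choose k) * 3 ^ (N - 3 * k - i))" for k
  define Y where "Y r = (p choose (3 * r + i)) * ((3 * r + i) choose (r + i)) * ((2 * r) choose r)" for r
  define V where "V s = n * (m choose (3 * s)) * ((3 * s) choose s) * ((2 * s) choose s)" for s
  define W where "W s = (-1) ^ (n + s) * int (V s) * (int ((n + s) choose s) * 3 ^ (m - 3 * s))" for s
  have set: "{k::nat. int k \<le> (int N - int i) div 3} = {k. 3 * k + i \<le> N}" by auto
  have X: "X k = ((3 * k + i) choose k) * ((2 * k + i) choose k) * (N choose (3 * k + i))" for k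
    unfolding X_def trinomial_eq by (simp only: mult_ac)
  have "a i N = (\<Sum>k | 3 * k + i \<le> N. T k)"
    unfolding a_def set by (rule sum.cong[OF refl]) (simp only: T_def X of_nat_mult mult_ac)
  \<comment> \<open>Padding with zero terms yields complete blocks; \<open>i \<ge> 1\<close> ensures
    that the original range lies below \<open>N\<close>.\<close>
  also have "\<dots> = (\<Sum>k<n * p. T k)"
    using assms(4) by (intro sum.mono_neutral_left) (auto simp: N_def mult.commute T_def X_def binomial_eq_0)
  also have "\<dots> = (\<Sum>s<n. \<Sum>r<p. T (p * s + r))"
    unfolding sum.nat_group[symmetric]
  proof (rule sum.cong[OF refl])
    fix s
    show "sum T {s * p..<s * p + p} = (\<Sum>r<p. T (p * s + r))"
      using sum.shift_bounds_nat_ivl[of T 0 "s * p" p]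
      by (simp only: add_0 lessThan_atLeast0 mult.commute add.commute)
  qed
  finally have "a i N = (\<Sum>s<n. \<Sum>r<p. T (p * s + r))" .
  also have "[\<dots> = (\<Sum>s<n. \<Sum>r<p. W s * ((-1) ^ r * int (Y r) * 3 ^ (p - 3 * r - i)))] (mod (int p)\<^sup>2)"
  proof (intro cong_sum)
    fix s r assume "s \<in> {..<n}" "r \<in> {..<p}"
    then have s: "s < n" and r: "r < p" by auto
    define k where "k = p * s + r"
    have XV: "[X k = V s * Y r] (mod p\<^sup>2)" and pX: "p dvd X k"
      using product_block_cong[OF assms(1,4) i r, of m s]
      unfolding X_def Y_def V_def N_def n k_def by auto
    then have XVi: "[int (X k) = int (V s) * int (Y r)] (mod (int p)\<^sup>2)"
      by (simp flip: cong_int_iff)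
    show "[T (p * s + r) = W s * ((-1) ^ r * int (Y r) * 3 ^ (p - 3 * r - i))] (mod (int p)\<^sup>2)"
    proof (cases "3 * k + i \<le> N \<and> 3 * r + i \<le> p")
      case False
      \<comment> \<open>Exponents may truncate here, but one product is 0, and by \<open>XVi\<close>
        both are then 0 modulo p^2.\<close>
      then have "X k = 0 \<or> Y r = 0" by (auto simp: X_def Y_def binomial_eq_0)
      then have "(int p)\<^sup>2 dvd int (X k) \<and> (int p)\<^sup>2 dvd int (V s) * int (Y r)"
        using XVi by (auto simp: cong_0_iff cong_sym_eq[of 0])
      then have "(int p)\<^sup>2 dvd T k" "(int p)\<^sup>2 dvd (-1) ^ (n + s) * (int ((n + s) choose s) * 3 ^ (m - 3 * s)) *
          ((-1) ^ r * 3 ^ (p - 3 * r - i)) * (int (V s) * int (Y r))"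
        unfolding T_def by (auto intro: dvd_mult dvd_mult2)
      then show ?thesis
        unfolding W_def k_def[symmetric]
        by (simp only: cong_iff_dvd_diff mult_ac dvd_diff)
    next
      case True
      have "p * (3 * s) + (3 * r + i) \<le> p * Suc m" using True by (simp add: k_def N_def n algebra_simps)
      \<comment> \<open>Strictness comes from \<open>i \<ge> 1\<close>; it gives
        \<open>3 * s \<le> m\<close>, so the exponent below splits without truncation.\<close>
      then have "p * (3 * s) < p * Suc m" using assms(4) by linarith
      then have sm: "3 * s \<le> m" by (simp only: mult_less_cancel1 less_Suc_eq_le)
      have exponent: "N - 3 * k - i = p * (m - 3 * s) + (p - 3 * r - i)"
        using True sm by (simp add: N_def n k_def algebra_simps)
      \<comment> \<open>For odd \<open>p\<close>, the number \<open>p * (n - s) - r\<close> has the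
        parity of \<open>n + s + r\<close>.\<close>
      have "odd p" using assms prime_odd_nat[of p] by simp
      moreover have "k \<le> N" using True by simp
      ultimately have "even (N - k) = even (n + s + r)"
        by (auto simp: N_def k_def)
      then have sign: "(-1) ^ (N - k) = (-1 :: int) ^ (n + s) * (-1) ^ r"
        by (simp add: minus_one_power_iff flip: power_add)
      have "N + (p * s + r) = p * (n + s) + r" by (simp add: N_def algebra_simps)
      then have "[(N + k) choose k = (n + s) choose s] (mod p)"
        unfolding k_def using binomial_lucas'[OF assms(1) r r, of "n + s" s] by (simp only: binomial_n_n mult_1_right)
      then have "[int ((N + k) choose k) = int ((n + s) choose s)] (mod int p)"
        by (simp only: cong_int_iff)
      moreover have "[3 ^ (N - 3 * k - i) = 3 ^ (m - 3 * s) * 3 ^ (p - 3 * r - i)] (mod int p)"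
        unfolding exponent power_add by (intro cong_mult three_pow_prime_mult_cong assms cong_refl)
      ultimately have "[int (X k) * (int ((N + k) choose k) * 3 ^ (N - 3 * k - i)) =
          int (X k) * (int ((n + s) choose s) * (3 ^ (m - 3 * s) * 3 ^ (p - 3 * r - i)))] (mod (int p)\<^sup>2)"
        using pX by (intro cong_mult_prime_square cong_mult) auto
      also have "[int (X k) * (int ((n + s) choose s) * (3 ^ (m - 3 * s) * 3 ^ (p - 3 * r - i))) =
          (int (V s) * int (Y r)) * (int ((n + s) choose s) * (3 ^ (m - 3 * s) * 3 ^ (p - 3 * r - i)))] (mod (int p)\<^sup>2)"
        using XVi by (rule cong_scalar_right)
      finally have "[(-1) ^ (N - k) * (int (X k) * (int ((N + k) choose k) * 3 ^ (N - 3 * k - i))) =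
          (-1) ^ (N - k) * ((int (V s) * int (Y r)) *
            (int ((n + s) choose s) * (3 ^ (m - 3 * s) * 3 ^ (p - 3 * r - i))))] (mod (int p)\<^sup>2)"
        by (rule cong_scalar_left)
      then show ?thesis
        unfolding T_def W_def k_def[symmetric] sign by (simp only: mult_ac)
    qed
  qed
  also have "(\<Sum>s<n. \<Sum>r<p. W s * ((-1) ^ r * int (Y r) * 3 ^ (p - 3 * r - i))) =
      (\<Sum>s<n. W s) * (\<Sum>r<p. (-1) ^ r * int (Y r) * 3 ^ (p - 3 * r - i))"
    by (rule sum_product[symmetric])
  also have "[\<dots> = (\<Sum>s<n. W s) * 0] (mod (int p)\<^sup>2)"
    unfolding Y_def by (intro cong_scalar_left truncated_sum_cong_0 assms i)
  finally show ?thesis by (simp add: N_def)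
qed

end
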